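(* Let $G$ be a group such that $x\otimes x=1_\otimes$ in $G\otimes G$ for all $x\in G$. Assume that $(A^\otimes(G))'\subseteq \mathrm{Aut}_c^\otimes(G)$, and that for all $\alpha\in\mathrm{Aut}(G)$ and all $x\in G$, the identity $\alpha(x)\otimes x=x\otimes\alpha(x)$ implies $x\otimes\alpha(x)=1_\otimes$. Then $A^\otimes(G)$ is a subgroup of $\mathrm{Aut}(G)$.
   Context: Conventions: $g^h=h^{-1}gh$. For a group $G$, the non-abelian tensor square $G\otimes G$ is the group generated by symbols $g\otimes h$ ($g,h\in G$) subject to the relations $gg'\otimes h=(g^{g'}\otimes h^{g'})(g'\otimes h)$ and $g\otimes hh'=(g\otimes h')(g^{h'}\otimes h^{h'})$ for all $g,g',h,h'\in G$; its identity is $1_\otimes$. Products of automorphisms are compositions, $\alpha\beta(x)=\alpha(\beta(x))$. $A^\otimes(G)$ is the set of tensor commuting automorphisms of $G$: those $\alpha\in \mathrm{Aut}(G)$ with $x\otimes\alpha(x)=1_\otimes$ for all $x\in G$. $(A^\otimes(G))'$ denotes the subgroup of $\mathrm{Aut}(G)$ generated by the commutators $[\alpha,\beta]=\alpha^{-1}\beta^{-1}\alpha\beta$ with $\alpha,\beta\in A^\otimes(G)$. $Z^\otimes(G)=\{a\in G : a\otimes x=1_\otimes \text{ for all } x\in G\}$ is the tensor center of $G$ (a subgroup). For $x\in G$ and $\alpha\in\mathrm{Aut}(G)$, $[x,\alpha]=x^{-1}\alpha(x)$. $\mathrm{Aut}_c^\otimes(G)$ is the subgroup of $\mathrm{Aut}(G)$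 consisting of the tensor central automorphisms: those $\alpha$ with $[x,\alpha]\in Z^\otimes(G)$ for all $x\in G$. *)

theory Defs
  imports "HOL-Algebra.Bij" "HOL-Algebra.Generated_Groups"
begin

section \<open>Groups given by generators and relations\<close>

text \<open>A word is a list of letters; \<open>(True, x)\<close> stands for the generator \<open>x\<close> and
  \<open>(False, x)\<close> for its formal inverse.\<close>

type_synonym 'g word = "(bool \<times> 'g) list"

definition words :: "'g set \<Rightarrow> 'g word set"
  where "words X = lists (UNIV \<times> X)"

inductive_set pres_cong :: "'g set \<Rightarrow> ('g word \<times> 'g word) set \<Rightarrow> ('g word \<times> 'g word) set"
  for X :: "'g set" and R :: "('g word \<times> 'g word) set"
  where
    refl: "w \<in> words X \<Longrightarrow> (w, w) \<in> pres_cong X R"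
  | sym: "(u, v) \<in> pres_cong X R \<Longrightarrow> (v, u) \<in> pres_cong X R"
  | trans: "(u, v) \<in> pres_cong X R \<Longrightarrow> (v, w) \<in> pres_cong X R \<Longrightarrow> (u, w) \<in> pres_cong X R"
  | append: "(u, v) \<in> pres_cong X R \<Longrightarrow> (u', v') \<in> pres_cong X R
      \<Longrightarrow> (u @ u', v @ v') \<in> pres_cong X R"
  | cancel: "x \<in> X \<Longrightarrow> ([(b, x), (\<not> b, x)], []) \<in> pres_cong X R"
  | rel: "(u, v) \<in> R \<Longrightarrow> u \<in> words X \<Longrightarrow> v \<in> words X \<Longrightarrow> (u, v) \<in> pres_cong X R"

definition presented_group :: "'g set \<Rightarrow> ('g word \<times> 'g word) set \<Rightarrow> 'g word set monoid"
  where "presented_group X R =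
    \<lparr>carrier = words X // pres_cong X R,
     monoid.mult = (\<lambda>A B. \<Union>u\<in>A. \<Union>v\<in>B. pres_cong X R `` {u @ v}),
     one = pres_cong X R `` {[]}\<rparr>"

lemma words_append [simp]: "u @ v \<in> words X \<longleftrightarrow> u \<in> words X \<and> v \<in> words X"
  by (auto simp: words_def)

lemma words_Nil [simp]: "[] \<in> words X"
  by (simp add: words_def)

lemma words_Cons [simp]: "l # w \<in> words X \<longleftrightarrow> snd l \<in> X \<and> w \<in> words X"
  by (cases l) (auto simp: words_def)

lemma pres_cong_words: "(u, v) \<in> pres_cong X R \<Longrightarrow> u \<in> words X \<and> v \<in> words X"
  by (induction rule: pres_cong.induct) auto

lemma equiv_pres_cong: "equiv (words X) (pres_cong X R)"
  by (rule equivI)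
    (auto simp: refl_on_def sym_on_def trans_on_def
      intro: pres_cong.refl pres_cong.sym pres_cong.trans dest: pres_cong_words)

lemma pres_cong_class_eq_iff:
  assumes "u \<in> words X" "v \<in> words X"
  shows "pres_cong X R `` {u} = pres_cong X R `` {v} \<longleftrightarrow> (u, v) \<in> pres_cong X R"
  using assms eq_equiv_class_iff[OF equiv_pres_cong] by blast

lemma presented_group_mult_class:
  assumes "u \<in> words X" "v \<in> words X"
  shows "pres_cong X R `` {u} \<otimes>\<^bsub>presented_group X R\<^esub> pres_cong X R `` {v}
    = pres_cong X R `` {u @ v}"
proof -
  have "congruent2 (pres_cong X R) (pres_cong X R) (\<lambda>u v. pres_cong X R `` {u @ v})"
    by (rule congruent2I')
      (auto intro!: equiv_class_eq[OF equiv_pres_cong] intro: pres_cong.append)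
  from UN_equiv_class2[OF equiv_pres_cong equiv_pres_cong this assms]
  show ?thesis by (simp add: presented_group_def)
qed

lemma pres_cong_inverse:
  assumes "w \<in> words X"
  shows "(rev (map (apfst Not) w) @ w, []) \<in> pres_cong X R"
  using assms
proof (induction w)
  case Nil
  then show ?case by (simp add: pres_cong.refl)
next
  case (Cons l w)
  obtain b x where l: "l = (b, x)" by (cases l)
  let ?w' = "rev (map (apfst Not) w)"
  have x: "x \<in> X" and w: "w \<in> words X" using Cons.prems l by auto
  note IH = Cons.IH[OF w]
  have w': "?w' \<in> words X" using pres_cong_words[OF IH] by simp
  have "([(\<not> b, x), (b, x)], []) \<in> pres_cong X R"
    using pres_cong.cancel[OF x, of "\<not> b"] by simp
  from pres_cong.append[OF pres_cong.refl[OF w'] pres_cong.append[OF this pres_cong.refl[OF w]]]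
  have "(?w' @ [(\<not> b, x), (b, x)] @ w, ?w' @ w) \<in> pres_cong X R" by simp
  from pres_cong.trans[OF this IH] show ?case by (simp add: l)
qed

lemma group_presented_group: "group (presented_group X R)"
proof (rule groupI)
  let ?P = "presented_group X R"
  let ?c = "\<lambda>w. pres_cong X R `` {w}"
  have carr: "carrier ?P = ?c ` words X" and one: "\<one>\<^bsub>?P\<^esub> = ?c []"
    by (auto simp: presented_group_def quotient_def)
  show "\<one>\<^bsub>?P\<^esub> \<in> carrier ?P" by (simp add: carr one)
  fix A assume "A \<in> carrier ?P"
  then obtain a where a: "a \<in> words X" "A = ?c a" by (auto simp: carr)
  show "\<one>\<^bsub>?P\<^esub> \<otimes>\<^bsub>?P\<^esub> A = A" using a by (simp add: one presented_group_mult_class)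
  let ?a = "rev (map (apfst Not) a)"
  have i: "(?a @ a, []) \<in> pres_cong X R" by (rule pres_cong_inverse[OF a(1)])
  then have a': "?a \<in> words X" using pres_cong_words by fastforce
  have "?c ?a \<otimes>\<^bsub>?P\<^esub> A = \<one>\<^bsub>?P\<^esub>"
    using a a' i by (simp add: one presented_group_mult_class pres_cong_class_eq_iff)
  then show "\<exists>B\<in>carrier ?P. B \<otimes>\<^bsub>?P\<^esub> A = \<one>\<^bsub>?P\<^esub>" using a' by (auto simp: carr)
  fix B assume "B \<in> carrier ?P"
  then obtain b where b: "b \<in> words X" "B = ?c b" by (auto simp: carr)
  show "A \<otimes>\<^bsub>?P\<^esub> B \<in> carrier ?P" using a b by (simp add: carr presented_group_mult_class)
  fix C assume "C \<in> carrier ?P"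
  then obtain c where c: "c \<in> words X" "C = ?c c" by (auto simp: carr)
  show "A \<otimes>\<^bsub>?P\<^esub> B \<otimes>\<^bsub>?P\<^esub> C = A \<otimes>\<^bsub>?P\<^esub> (B \<otimes>\<^bsub>?P\<^esub> C)"
    using a b c by (simp add: presented_group_mult_class)
qed


section \<open>The non-abelian tensor square\<close>

definition conj_by :: "('a, 'b) monoid_scheme \<Rightarrow> 'a \<Rightarrow> 'a \<Rightarrow> 'a"
  where "conj_by G g h = inv\<^bsub>G\<^esub> h \<otimes>\<^bsub>G\<^esub> g \<otimes>\<^bsub>G\<^esub> h"

definition tensor_relations :: "('a, 'b) monoid_scheme \<Rightarrow> (('a \<times> 'a) word \<times> ('a \<times> 'a) word) set"
  where "tensor_relations G =
    {([(True, (g \<otimes>\<^bsub>G\<^esub> g', h))],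
      [(True, (conj_by G g g', conj_by G h g')), (True, (g', h))]) | g g' h.
        g \<in> carrier G \<and> g' \<in> carrier G \<and> h \<in> carrier G} \<union>
    {([(True, (g, h \<otimes>\<^bsub>G\<^esub> h'))],
      [(True, (g, h')), (True, (conj_by G g h', conj_by G h h'))]) | g h h'.
        g \<in> carrier G \<and> h \<in> carrier G \<and> h' \<in> carrier G}"

definition tensor_square :: "('a, 'b) monoid_scheme \<Rightarrow> ('a \<times> 'a) word set monoid"
  where "tensor_square G = presented_group (carrier G \<times> carrier G) (tensor_relations G)"

definition tensor :: "('a, 'b) monoid_scheme \<Rightarrow> 'a \<Rightarrow> 'a \<Rightarrow> ('a \<times> 'a) word set"
  where "tensor G g h =
    pres_cong (carrier G \<times> carrier G) (tensor_relations G) `` {[(True, (g, h))]}"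

lemma group_tensor_square: "group (tensor_square G)"
  by (simp add: tensor_square_def group_presented_group)

lemma tensor_closed:
  "g \<in> carrier G \<Longrightarrow> h \<in> carrier G \<Longrightarrow> tensor G g h \<in> carrier (tensor_square G)"
  by (auto simp: tensor_def tensor_square_def presented_group_def intro: quotientI)

lemma (in group) conj_by_closed:
  "g \<in> carrier G \<Longrightarrow> h \<in> carrier G \<Longrightarrow> conj_by G g h \<in> carrier G"
  by (simp add: conj_by_def)

lemma (in group) tensor_mult_left:
  assumes "g \<in> carrier G" "g' \<in> carrier G" "h \<in> carrier G"
  shows "tensor G (g \<otimes> g') h =
    tensor G (conj_by G g g') (conj_by G h g') \<otimes>\<^bsub>tensor_square G\<^esub> tensor G g' h"
  using assms unfolding tensor_def tensor_square_def
  by (subst presented_group_mult_class)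
    (auto simp: conj_by_closed pres_cong_class_eq_iff tensor_relations_def intro!: pres_cong.rel)

lemma (in group) tensor_mult_right:
  assumes "g \<in> carrier G" "h \<in> carrier G" "h' \<in> carrier G"
  shows "tensor G g (h \<otimes> h') =
    tensor G g h' \<otimes>\<^bsub>tensor_square G\<^esub> tensor G (conj_by G g h') (conj_by G h h')"
  using assms unfolding tensor_def tensor_square_def
  by (subst presented_group_mult_class)
    (auto simp: conj_by_closed pres_cong_class_eq_iff tensor_relations_def intro!: pres_cong.rel)


section \<open>Tensor commuting and tensor central automorphisms\<close>

text \<open>\<^const>\<open>AutoGroup\<close> multiplies by composition, \<open>(\<alpha> \<otimes> \<beta>) x = \<alpha> (\<beta> x)\<close>; its elements are
  extensional functions on the carrier.\<close>

definition tensor_commuting_auts :: "('a, 'b) monoid_scheme \<Rightarrow> ('a \<Rightarrow> 'a) set"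
  where "tensor_commuting_auts G =
    {\<alpha> \<in> carrier (AutoGroup G). \<forall>x\<in>carrier G. tensor G x (\<alpha> x) = \<one>\<^bsub>tensor_square G\<^esub>}"

definition tensor_center :: "('a, 'b) monoid_scheme \<Rightarrow> 'a set"
  where "tensor_center G =
    {a \<in> carrier G. \<forall>x\<in>carrier G. tensor G a x = \<one>\<^bsub>tensor_square G\<^esub>}"

definition tensor_central_auts :: "('a, 'b) monoid_scheme \<Rightarrow> ('a \<Rightarrow> 'a) set"
  where "tensor_central_auts G =
    {\<alpha> \<in> carrier (AutoGroup G). \<forall>x\<in>carrier G. inv\<^bsub>G\<^esub> x \<otimes>\<^bsub>G\<^esub> \<alpha> x \<in> tensor_center G}"

text \<open>The library's \<^const>\<open>derived\<close> uses the commutator \<open>\<alpha> \<beta> \<alpha>\<inverse> \<beta>\<inverse>\<close>; here the convention is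
  \<open>\<alpha>\<inverse> \<beta>\<inverse> \<alpha> \<beta>\<close>, which may generate a different subgroup when \<open>A\<close> is not closed under
  inverses.\<close>

definition commutator_subgroup :: "('a, 'b) monoid_scheme \<Rightarrow> 'a set \<Rightarrow> 'a set"
  where "commutator_subgroup H A = generate H
    {inv\<^bsub>H\<^esub> \<alpha> \<otimes>\<^bsub>H\<^esub> inv\<^bsub>H\<^esub> \<beta> \<otimes>\<^bsub>H\<^esub> \<alpha> \<otimes>\<^bsub>H\<^esub> \<beta> | \<alpha> \<beta>. \<alpha> \<in> A \<and> \<beta> \<in> A}"

end

theory Submission
  imports Defs
begin

text \<open>Since \<open>x \<otimes> x = 1\<close>, expanding \<open>xy \<otimes> xy\<close> shows \<open>y \<otimes> x = (x \<otimes> y)\<inverse>\<close>. If \<open>\<alpha>\<close> is tensor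
  commuting, then \<open>y\<close> and \<open>\<alpha> y\<close> commute (by the commutator map \<open>g \<otimes> h \<mapsto> [g, h]\<close>), and expanding
  \<open>xy \<otimes> \<alpha>(xy) = 1\<close> yields the adjunction \<open>\<alpha> x \<otimes> y = x \<otimes> \<alpha> y\<close>. For two such automorphisms this gives
  \<open>\<alpha>\<beta>(x) \<otimes> x = x \<otimes> \<beta>\<alpha>(x)\<close>. As \<open>[\<alpha>, \<beta>]\<close> is tensor central, \<open>\<alpha>\<beta>(x)\<close> and \<open>\<beta>\<alpha>(x)\<close> differ by an element
  of the tensor center, so \<open>\<alpha>\<beta>(x) \<otimes> x = x \<otimes> \<alpha>\<beta>(x)\<close>, and the last hypothesis applies.\<close>

section \<open>Words evaluated in a group, and maps out of the tensor square\<close>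

definition eval_word :: "('c, 'd) monoid_scheme \<Rightarrow> ('g \<Rightarrow> 'c) \<Rightarrow> 'g word \<Rightarrow> 'c" where
  "eval_word H f w =
    foldr (\<lambda>(b, x) a. (if b then f x else inv\<^bsub>H\<^esub> f x) \<otimes>\<^bsub>H\<^esub> a) w \<one>\<^bsub>H\<^esub>"

lemma eval_word_Nil [simp]: "eval_word H f [] = \<one>\<^bsub>H\<^esub>"
  and eval_word_Cons [simp]: "eval_word H f ((b, x) # w) =
    (if b then f x else inv\<^bsub>H\<^esub> f x) \<otimes>\<^bsub>H\<^esub> eval_word H f w"
  by (simp_all add: eval_word_def)

context group
begin

lemma eval_word_closed:
  "f \<in> X \<rightarrow> carrier G \<Longrightarrow> w \<in> words X \<Longrightarrow> eval_word G f w \<in> carrier G"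
  by (induction w) (auto simp: Pi_iff)

lemma eval_word_append:
  assumes "f \<in> X \<rightarrow> carrier G" "u \<in> words X" "v \<in> words X"
  shows "eval_word G f (u @ v) = eval_word G f u \<otimes> eval_word G f v"
  using assms(2)
proof (induction u)
  case Nil
  then show ?case using eval_word_closed[OF assms(1,3)] by simp
next
  case (Cons l u)
  obtain b x where "l = (b, x)" by (cases l)
  then show ?case
    using Cons assms(1) eval_word_closed[OF assms(1)] assms(3) by (auto simp: Pi_iff m_assoc)
qed

text \<open>Von Dyck's theorem at the level of words: evaluation is multiplicative and kills
  cancelling pairs, so it descends to the presented group once it respects \<open>R\<close>.\<close>

lemma eval_word_cong:
  assumes f: "f \<in> X \<rightarrow> carrier G"
    and R: "\<And>u v. (u, v) \<in> R \<Longrightarrow> u \<in> words X \<Longrightarrow> v \<in> words X \<Longrightarrow> eval_word G f u = eval_word G f v"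
    and "(u, v) \<in> pres_cong X R"
  shows "eval_word G f u = eval_word G f v"
  using assms(3)
proof (induction rule: pres_cong.induct)
  case (append u v u' v')
  then show ?case
    using eval_word_append[OF f] pres_cong_words[OF append.hyps(1)] pres_cong_words[OF append.hyps(2)]
    by simp
next
  case (cancel x b)
  then show ?case using f by (auto simp: Pi_iff)
qed (use R in auto)

text \<open>By \<open>left\<close> and \<open>right\<close>, \<open>f\<close> is a crossed pairing,
  so it induces a homomorphism from the tensor square to \<open>H\<close>, which preserves the
  identity. The proof stays with words: \<open>one\<close> says that a one-letter word is congruent
  to the empty word, and both are evaluated in \<open>H\<close>.\<close>

lemma tensor_lift_one:
  assumes one: "tensor G g h = \<one>\<^bsub>tensor_square G\<^esub>"
    and gh: "g \<in> carrier G" "h \<in> carrier G"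
    and H: "group H"
    and f: "\<And>g h. g \<in> carrier G \<Longrightarrow> h \<in> carrier G \<Longrightarrow> f g h \<in> carrier H"
    and left: "\<And>g g' h. g \<in> carrier G \<Longrightarrow> g' \<in> carrier G \<Longrightarrow> h \<in> carrier G \<Longrightarrow>
      f (g \<otimes> g') h = f (conj_by G g g') (conj_by G h g') \<otimes>\<^bsub>H\<^esub> f g' h"
    and right: "\<And>g h h'. g \<in> carrier G \<Longrightarrow> h \<in> carrier G \<Longrightarrow> h' \<in> carrier G \<Longrightarrow>
      f g (h \<otimes> h') = f g h' \<otimes>\<^bsub>H\<^esub> f (conj_by G g h') (conj_by G h h')"
  shows "f g h = \<one>\<^bsub>H\<^esub>"
proof -
  interpret H: group H by (rule H)
  let ?X = "carrier G \<times> carrier G"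
  have F: "case_prod f \<in> ?X \<rightarrow> carrier H" using f by auto
  have "([(True, (g, h))], []) \<in> pres_cong ?X (tensor_relations G)"
    using one gh
    by (simp add: tensor_def tensor_square_def presented_group_def pres_cong_class_eq_iff)
  then have "eval_word H (case_prod f) [(True, (g, h))] = eval_word H (case_prod f) []"
  proof (rule H.eval_word_cong[OF F, rotated])
    fix u v assume "(u, v) \<in> tensor_relations G"
    then show "eval_word H (case_prod f) u = eval_word H (case_prod f) v"
      by (auto simp: tensor_relations_def f left right conj_by_closed)
  qed
  then show ?thesis using f[OF gh] by simp
qed

section \<open>Conjugation and trivial tensors\<close>

lemma conj_by_mult:
  assumes "g \<in> carrier G" "h \<in> carrier G" "w \<in> carrier G"
  shows "conj_by G (g \<otimes> h) w = conj_by G g w \<otimes> conj_by G h w"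
  using assms by (simp add: conj_by_def m_assoc inv_solve_left' flip: m_assoc[of w "inv w"])

lemma conj_by_hom: "w \<in> carrier G \<Longrightarrow> (\<lambda>g. conj_by G g w) \<in> hom G G"
  by (auto simp: hom_def conj_by_closed conj_by_mult)

lemma conj_by_conj_by:
  assumes "g \<in> carrier G" "h \<in> carrier G" "w \<in> carrier G"
  shows "conj_by G (conj_by G g h) w = conj_by G g (h \<otimes> w)"
  using assms by (simp add: conj_by_def m_assoc inv_mult_group)

lemma conj_by_one_right [simp]: "w \<in> carrier G \<Longrightarrow> conj_by G w \<one> = w"
  and conj_by_self [simp]: "w \<in> carrier G \<Longrightarrow> conj_by G w w = w"
  by (simp_all add: conj_by_def)

lemma conj_by_inv_cancel [simp]:
  assumes "g \<in> carrier G" "w \<in> carrier G"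
  shows "conj_by G (conj_by G g (inv w)) w = g"
  using assms by (simp add: conj_by_conj_by)

lemma hom_conj_by:
  assumes "\<phi> \<in> hom G G" "g \<in> carrier G" "h \<in> carrier G"
  shows "\<phi> (conj_by G g h) = conj_by G (\<phi> g) (\<phi> h)"
proof -
  interpret group_hom G G \<phi> using assms(1) by unfold_locales
  show ?thesis using assms(2,3) by (simp add: conj_by_def)
qed

text \<open>The tensor square is functorial: \<phi> respects products and conjugation, so sending g,
  h to the tensor of their images is a crossed pairing. It is applied below to inner
  automorphisms.\<close>

lemma tensor_hom_one:
  assumes \<phi>: "\<phi> \<in> hom G G" and gh: "g \<in> carrier G" "h \<in> carrier G"
    and "tensor G g h = \<one>\<^bsub>tensor_square G\<^esub>"
  shows "tensor G (\<phi> g) (\<phi> h) = \<one>\<^bsub>tensor_square G\<^esub>"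
proof (rule tensor_lift_one[OF assms(4) gh group_tensor_square, where f = "\<lambda>g h. tensor G (\<phi> g) (\<phi> h)"])
qed (use hom_in_carrier[OF \<phi>] in
    \<open>simp_all add: tensor_closed hom_mult[OF \<phi>] hom_conj_by[OF \<phi>] tensor_mult_left tensor_mult_right\<close>)

lemma tensor_one_imp_commute:
  assumes gh: "g \<in> carrier G" "h \<in> carrier G"
    and "tensor G g h = \<one>\<^bsub>tensor_square G\<^esub>"
  shows "conj_by G g h = g" "conj_by G h g = h"
proof -
  have [simp]: "x \<otimes> (inv x \<otimes> y) = y" "inv x \<otimes> (x \<otimes> y) = y"
    if "x \<in> carrier G" "y \<in> carrier G" for x y
    using that by (simp_all flip: m_assoc)
  \<comment> \<open>The left side is the commutator [g, h], a crossed pairing with values in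
    \<open>G\<close> itself.\<close>
  have "inv g \<otimes> conj_by G g h = \<one>"
    by (rule tensor_lift_one[OF assms(3) gh is_group, where f = "\<lambda>g h. inv g \<otimes> conj_by G g h"])
      (simp_all add: conj_by_def m_assoc inv_mult_group)
  then show g: "conj_by G g h = g"
    using gh by (metis conj_by_closed inv_closed inv_equality inv_inv)
  have "g \<otimes> h = h \<otimes> g"
    using gh arg_cong[OF g, of "\<lambda>y. h \<otimes> y"] by (simp add: conj_by_def m_assoc)
  then show "conj_by G h g = h"
    using gh by (simp add: conj_by_def m_assoc)
       (metis \<open>\<And>y x. x \<in> carrier G \<Longrightarrow> y \<in> carrier G \<Longrightarrow> inv x \<otimes> (x \<otimes> y) = y\<close>)
qed

end

section \<open>Groups whose diagonal tensors are trivial\<close>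

locale tensor_alternating_group = group +
  assumes tensor_self: "x \<in> carrier G \<Longrightarrow> tensor G x x = \<one>\<^bsub>tensor_square G\<^esub>"
begin

sublocale T: group "tensor_square G" by (rule group_tensor_square)

lemma tensor_swap:
  assumes x: "x \<in> carrier G" and y: "y \<in> carrier G"
  shows "tensor G y x = inv\<^bsub>tensor_square G\<^esub> tensor G x y"
proof -
  \<comment> \<open>The expansion produces x^y where x is wanted. As x is arbitrary here, replacing
    it by its conjugate under \<open>inv y\<close> repairs this afterwards.\<close>
  have *: "tensor G (conj_by G x y) y \<otimes>\<^bsub>tensor_square G\<^esub> tensor G y (conj_by G x y)
      = \<one>\<^bsub>tensor_square G\<^esub>" if x: "x \<in> carrier G" for x
  proof -
    have "\<one>\<^bsub>tensor_square G\<^esub> = tensor G (x \<otimes> y) (x \<otimes> y)"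
      using x y by (simp add: tensor_self)
    also have "\<dots> = tensor G (conj_by G x y) (conj_by G x y \<otimes> y) \<otimes>\<^bsub>tensor_square G\<^esub> tensor G y (x \<otimes> y)"
      using x y by (simp add: tensor_mult_left conj_by_mult)
    also have "\<dots> = tensor G (conj_by G x y) y \<otimes>\<^bsub>tensor_square G\<^esub> tensor G y (conj_by G x y)"
      using x y by (simp add: tensor_mult_right conj_by_closed tensor_self tensor_closed)
    finally show ?thesis by simp
  qed
  have "tensor G x y \<otimes>\<^bsub>tensor_square G\<^esub> tensor G y x = \<one>\<^bsub>tensor_square G\<^esub>"
    using *[of "conj_by G x (inv y)"] x y by (simp add: conj_by_closed)
  then show ?thesis
    using x y by (metis T.inv_equality T.inv_inv tensor_closed T.inv_closed)
qed

lemma tensor_commuting_adjoint: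
  assumes \<alpha>: "\<alpha> \<in> hom G G"
    and \<alpha>1: "\<And>x. x \<in> carrier G \<Longrightarrow> tensor G x (\<alpha> x) = \<one>\<^bsub>tensor_square G\<^esub>"
    and x: "x \<in> carrier G" and y: "y \<in> carrier G"
  shows "tensor G (\<alpha> x) y = tensor G x (\<alpha> y)"
proof -
  note cl = hom_in_carrier[OF \<alpha>] conj_by_closed tensor_closed
  \<comment> \<open>Chosen so that u^y = x: expanding the tensor of uy with its image under \<alpha>
    then yields x and \<alpha> x directly, not their conjugates.\<close>
  define u where "u = conj_by G x (inv y)"
  have u: "u \<in> carrier G" and uy: "conj_by G u y = x"
    using x y by (simp_all add: u_def conj_by_closed)
  have comm: "conj_by G y (\<alpha> y) = y" "conj_by G (\<alpha> y) y = \<alpha> y"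
    using tensor_one_imp_commute[OF y _ \<alpha>1[OF y]] y by (simp_all add: cl)
  have \<alpha>u: "conj_by G (\<alpha> u) (\<alpha> y) = \<alpha> x"
    using hom_conj_by[OF \<alpha> u y] uy by simp
  \<comment> \<open>This unwanted factor of the expansion is the trivial tensor of u and \<alpha> u,
    conjugated by y times \<alpha> y.\<close>
  have conj1: "tensor G (conj_by G x (\<alpha> y)) (conj_by G (conj_by G (\<alpha> u) y) (\<alpha> y)) = \<one>\<^bsub>tensor_square G\<^esub>"
    using tensor_hom_one[OF conj_by_hom[of "y \<otimes> \<alpha> y"] u _ \<alpha>1[OF u]] u y
    by (simp add: cl uy flip: conj_by_conj_by)
  have "\<one>\<^bsub>tensor_square G\<^esub> = tensor G (u \<otimes> y) (\<alpha> u \<otimes> \<alpha> y)"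
    using \<alpha>1[of "u \<otimes> y"] u y by (simp add: hom_mult[OF \<alpha>])
  also have "\<dots> = tensor G x (conj_by G (\<alpha> u) y \<otimes> \<alpha> y) \<otimes>\<^bsub>tensor_square G\<^esub> tensor G y (\<alpha> u \<otimes> \<alpha> y)"
    using u y by (simp add: cl tensor_mult_left uy conj_by_mult comm)
  also have "tensor G x (conj_by G (\<alpha> u) y \<otimes> \<alpha> y) = tensor G x (\<alpha> y)"
    using u x y by (simp add: cl tensor_mult_right conj1)
  also have "tensor G y (\<alpha> u \<otimes> \<alpha> y) = tensor G y (\<alpha> x)"
    using u x y by (simp add: cl tensor_mult_right \<alpha>1 comm \<alpha>u)
  finally have "inv\<^bsub>tensor_square G\<^esub> tensor G y (\<alpha> x) = tensor G x (\<alpha> y)"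
    using x y by (intro T.inv_equality) (simp_all add: cl)
  then show ?thesis using tensor_swap[of y "\<alpha> x"] x y by (simp add: cl)
qed

text \<open>Writing yz as z' y, with z' the conjugate of z by \<open>inv y\<close>, makes the right
  expansion return the tensor of x and y, times that of x^y and z. The latter is trivial by
  \<open>tensor_swap\<close>, since the tensor center is defined through left arguments.\<close>

lemma tensor_mult_center:
  assumes x: "x \<in> carrier G" and y: "y \<in> carrier G" and z: "z \<in> tensor_center G"
  shows "tensor G x (y \<otimes> z) = tensor G x y"
proof -
  have zc: "z \<in> carrier G" and z1: "\<And>x. x \<in> carrier G \<Longrightarrow> tensor G x z = \<one>\<^bsub>tensor_square G\<^esub>"
    using z tensor_swap[of z] by (auto simp: tensor_center_def)
  have "y \<otimes> z = conj_by G z (inv y) \<otimes> y"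
    using y zc by (simp add: conj_by_def m_assoc)
  then show ?thesis
    using x y zc by (simp add: tensor_mult_right conj_by_closed z1 tensor_closed)
qed

end

theorem theorem3p4:
  fixes G :: "('a, 'b) monoid_scheme"
  assumes "group G"
    and "\<And>x. x \<in> carrier G \<Longrightarrow> tensor G x x = \<one>\<^bsub>tensor_square G\<^esub>"
    and "commutator_subgroup (AutoGroup G) (tensor_commuting_auts G) \<subseteq> tensor_central_auts G"
    and "\<And>\<alpha> x. \<alpha> \<in> carrier (AutoGroup G) \<Longrightarrow> x \<in> carrier G \<Longrightarrow>
           tensor G (\<alpha> x) x = tensor G x (\<alpha> x) \<Longrightarrow> tensor G x (\<alpha> x) = \<one>\<^bsub>tensor_square G\<^esub>"
  shows "subgroup (tensor_commuting_auts G) (AutoGroup G)"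
proof -
  interpret tensor_alternating_group G
    using assms(1,2) by (simp add: tensor_alternating_group_def tensor_alternating_group_axioms_def)
  interpret A: group "AutoGroup G" by (rule AutoGroup)
  let ?A = "AutoGroup G" and ?C = "tensor_commuting_auts G"
  have autD: "\<alpha> \<in> hom G G" if "\<alpha> \<in> carrier ?A" for \<alpha>
    using that by (simp add: AutoGroup_def auto_def)
  have closed: "\<alpha> x \<in> carrier G" if "\<alpha> \<in> carrier ?A" "x \<in> carrier G" for \<alpha> x
    using hom_in_carrier[OF autD] that by blast
  have mult: "(\<alpha> \<otimes>\<^bsub>?A\<^esub> \<beta>) x = \<alpha> (\<beta> x)"
    if "\<alpha> \<in> carrier ?A" "\<beta> \<in> carrier ?A" "x \<in> carrier G" for \<alpha> \<beta> x
    using that by (simp add: AutoGroup_def BijGroup_def auto_def compose_def)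
  have one: "\<one>\<^bsub>?A\<^esub> x = x" if "x \<in> carrier G" for x
    using that by (simp add: AutoGroup_def BijGroup_def)
  have inv: "\<alpha> ((inv\<^bsub>?A\<^esub> \<alpha>) x) = x" if "\<alpha> \<in> carrier ?A" "x \<in> carrier G" for \<alpha> x
    using mult[of \<alpha> "inv\<^bsub>?A\<^esub> \<alpha>" x] one that by simp
  have CD: "\<alpha> \<in> carrier ?A" if "\<alpha> \<in> ?C" for \<alpha>
    using that by (simp add: tensor_commuting_auts_def)
  have adj: "tensor G (\<alpha> x) y = tensor G x (\<alpha> y)"
    if "\<alpha> \<in> ?C" "x \<in> carrier G" "y \<in> carrier G" for \<alpha> x y
    using that by (intro tensor_commuting_adjoint) (auto simp: autD tensor_commuting_auts_def)
  \<comment> \<open>The adjunction moves \<alpha> from z to the other argument, where any element is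
    allowed.\<close>
  have center: "\<alpha> z \<in> tensor_center G" if "\<alpha> \<in> ?C" "z \<in> tensor_center G" for \<alpha> z
    using that adj[OF that(1)] closed[OF CD[OF that(1)]] by (simp add: tensor_center_def)
  show ?thesis
  proof (rule A.subgroupI)
    show "?C \<subseteq> carrier ?A" using CD by blast
    have "\<one>\<^bsub>?A\<^esub> \<in> ?C" by (simp add: tensor_commuting_auts_def one tensor_self)
    then show "?C \<noteq> {}" by blast
  next
    fix \<alpha> assume \<alpha>: "\<alpha> \<in> ?C"
    have "tensor G x ((inv\<^bsub>?A\<^esub> \<alpha>) x) = \<one>\<^bsub>tensor_square G\<^esub>" if x: "x \<in> carrier G" for x
    proof -
      let ?y = "(inv\<^bsub>?A\<^esub> \<alpha>) x"
      have y: "?y \<in> carrier G" using closed[OF A.inv_closed[OF CD[OF \<alpha>]] x] .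
      then have "tensor G ?y x = \<one>\<^bsub>tensor_square G\<^esub>"
        using \<alpha> inv[OF CD[OF \<alpha>] x] by (force simp: tensor_commuting_auts_def)
      then show ?thesis using tensor_swap[OF y x] by simp
    qed
    then show "inv\<^bsub>?A\<^esub> \<alpha> \<in> ?C" using CD[OF \<alpha>] by (simp add: tensor_commuting_auts_def)
  next
    fix \<alpha> \<beta> assume \<alpha>: "\<alpha> \<in> ?C" and \<beta>: "\<beta> \<in> ?C"
    note c = CD[OF \<alpha>] CD[OF \<beta>]
    define \<gamma> where "\<gamma> = inv\<^bsub>?A\<^esub> \<alpha> \<otimes>\<^bsub>?A\<^esub> inv\<^bsub>?A\<^esub> \<beta> \<otimes>\<^bsub>?A\<^esub> \<alpha> \<otimes>\<^bsub>?A\<^esub> \<beta>"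
    have \<gamma>c: "\<gamma> \<in> carrier ?A" using c by (simp add: \<gamma>_def)
    have "\<gamma> \<in> commutator_subgroup ?A ?C"
      unfolding commutator_subgroup_def \<gamma>_def using \<alpha> \<beta> by (intro generate.incl) blast
    then have \<gamma>: "\<gamma> \<in> tensor_central_auts G" using assms(3) by blast
    have "\<gamma> = inv\<^bsub>?A\<^esub> (\<beta> \<otimes>\<^bsub>?A\<^esub> \<alpha>) \<otimes>\<^bsub>?A\<^esub> (\<alpha> \<otimes>\<^bsub>?A\<^esub> \<beta>)"
      using c by (simp add: \<gamma>_def A.m_assoc A.inv_mult_group)
    \<comment> \<open>With this convention the commutator measures \<alpha>\<beta> against
      \<beta>\<alpha> by a factor on the right, which is applied first.\<close>
    then have \<alpha>\<beta>: "\<alpha> \<otimes>\<^bsub>?A\<^esub> \<beta> = \<beta> \<otimes>\<^bsub>?A\<^esub> \<alpha> \<otimes>\<^bsub>?A\<^esub> \<gamma>"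
      using c \<gamma>c by (simp add: A.inv_solve_left)
    have "tensor G x ((\<alpha> \<otimes>\<^bsub>?A\<^esub> \<beta>) x) = \<one>\<^bsub>tensor_square G\<^esub>" if x: "x \<in> carrier G" for x
    proof (rule assms(4)[OF A.m_closed[OF c] x])
      note cl = closed[OF c(1)] closed[OF c(2)] closed[OF \<gamma>c] x
      \<comment> \<open>This is [x, \<gamma>]. Its image under \<beta>\<alpha> is the discrepancy
        between \<alpha>\<beta>(x) and \<beta>\<alpha>(x), and it stays in the tensor center by
        \<open>center\<close>.\<close>
      define z where "z = inv\<^bsub>G\<^esub> x \<otimes>\<^bsub>G\<^esub> \<gamma> x"
      have z: "z \<in> tensor_center G" using \<gamma> x by (simp add: z_def tensor_central_auts_def)
      then have zc: "z \<in> carrier G" by (simp add: tensor_center_def)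
      have "\<gamma> x = x \<otimes>\<^bsub>G\<^esub> z" using cl by (simp add: z_def flip: m_assoc)
      then have "(\<alpha> \<otimes>\<^bsub>?A\<^esub> \<beta>) x = \<beta> (\<alpha> x) \<otimes>\<^bsub>G\<^esub> \<beta> (\<alpha> z)"
        using c \<gamma>c cl zc by (simp add: \<alpha>\<beta> mult hom_mult[OF autD])
      then have "tensor G x ((\<alpha> \<otimes>\<^bsub>?A\<^esub> \<beta>) x) = tensor G x (\<beta> (\<alpha> x))"
        using tensor_mult_center center \<alpha> \<beta> z cl by simp
      \<comment> \<open>The adjunction, used once for each automorphism, passes both to the left
        argument and thereby reverses their order.\<close>
      also have "\<dots> = tensor G ((\<alpha> \<otimes>\<^bsub>?A\<^esub> \<beta>) x) x"
        using c cl by (simp add: mult adj[OF \<alpha>] adj[OF \<beta>])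
      finally show "tensor G ((\<alpha> \<otimes>\<^bsub>?A\<^esub> \<beta>) x) x = tensor G x ((\<alpha> \<otimes>\<^bsub>?A\<^esub> \<beta>) x)" ..
    qed
    then show "\<alpha> \<otimes>\<^bsub>?A\<^esub> \<beta> \<in> ?C" using c by (simp add: tensor_commuting_auts_def)
  qed
qed

end
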